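(* Let $(X,M,N,*,\diamond)$ be an intuitionistic fuzzy metric space and let $A\subseteq X$. Then $A$ is compact if and only if $A$ is precompact and complete.
   Context: A continuous t-norm is a binary operation $*:[0,1]\times[0,1]\to[0,1]$ that is associative, commutative, continuous, satisfies $a*1=a$ for all $a\in[0,1]$, and satisfies $a*b\le c*d$ whenever $a\le c$ and $b\le d$. A continuous t-conorm is a binary operation $\diamond:[0,1]\times[0,1]\to[0,1]$ that is associative, commutative, continuous, satisfies $a\diamond 0=a$ for all $a\in[0,1]$, and satisfies $a\diamond b\le c\diamond d$ whenever $a\le c$ and $b\le d$. An intuitionistic fuzzy metric space is a 5-tuple $(X,M,N,*,\diamond)$ where $X$ is a non-empty set, $*$ is a continuous t-norm, $\diamond$ is a continuous t-conorm, and $M,N:X\times X\times(0,\infty)\to[0,1]$ satisfy, for all $x,y,z\in X$ and $t,s>0$: (a) $M(x,y,t)+N(x,y,t)\le 1$; (b) $M(x,y,t)>0$; (c) $M(x,y,t)=1$ if and only if $x=y$; (d) $M(x,y,t)=M(y,x,t)$; (e) $M(x,y,t)*M(y,z,s)\le M(x,z,t+s)$; (f) $M(x,y,\cdot):(0,\infty)\to[0,1]$ is continuous; (g) $N(x,y,t)<1$; (h) $N(x,y,t)=0$ if and only if $x=y$; (i) $N(x,y,t)=N(y,x,t)$; (j) $N(x,y,t)\diamond N(y,z,s)\ge N(x,z,t+s)$; (k) $N(x,y,\cdot):(0,\infty)\to[0,1]$ is continuous. For $x\in X$, $0<r<1$, $t>0$, put $B(x,r,t)=\{y\in X: M(x,y,t)>1-r,\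 N(x,y,t)<r\}$. The topology $\tau_{(M,N)}$ on $X$ consists of all $U\subseteq X$ such that for each $x\in U$ there exist $t>0$ and $0<r<1$ with $B(x,r,t)\subseteq U$. Compactness of $A$ is with respect to $\tau_{(M,N)}$ (every open cover has a finite subcover). A sequence $\{x_n\}$ converges to $x$ if and only if $M(x_n,x,t)\to1$ and $N(x_n,x,t)\to0$ for each $t>0$. It is Cauchy if for each $0<\varepsilon<1$ and $t>0$ there is $n_0\in\mathbb{N}$ with $M(x_n,x_m,t)>1-\varepsilon$ and $N(x_n,x_m,t)<\varepsilon$ for all $n,m\ge n_0$. A subset $A$ is complete if every Cauchy sequence in $A$ converges to a point of $A$. A subset $A$ is precompact if for each $0<r<1$ and $t>0$ there is a finite subset $S$ of $A$ with $A\subseteq\bigcup_{x\in S}B(x,r,t)$. *)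

theory Defs
  imports "HOL-Analysis.Analysis"
begin

text \<open>
  Operations on the unit interval are represented by functions on all reals, and the functions
  \<open>M\<close> and \<open>N\<close> by total functions. The axioms constrain them only on the unit interval, on the
  carrier and at positive parameters; other values are arbitrary and are never used.
\<close>

locale continuous_t_norm =
  fixes T :: "real \<Rightarrow> real \<Rightarrow> real"
  assumes closed: "\<lbrakk>a \<in> {0..1}; b \<in> {0..1}\<rbrakk> \<Longrightarrow> T a b \<in> {0..1}"
    and assoc: "\<lbrakk>a \<in> {0..1}; b \<in> {0..1}; c \<in> {0..1}\<rbrakk> \<Longrightarrow> T (T a b) c = T a (T b c)"
    and comm: "\<lbrakk>a \<in> {0..1}; b \<in> {0..1}\<rbrakk> \<Longrightarrow> T a b = T b a"
    and cont: "continuous_on ({0..1} \<times> {0..1}) (\<lambda>(a, b). T a b)"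
    and unit: "a \<in> {0..1} \<Longrightarrow> T a 1 = a"
    and mono: "\<lbrakk>a \<in> {0..1}; b \<in> {0..1}; c \<in> {0..1}; d \<in> {0..1}; a \<le> c; b \<le> d\<rbrakk>
      \<Longrightarrow> T a b \<le> T c d"

locale continuous_t_conorm =
  fixes S :: "real \<Rightarrow> real \<Rightarrow> real"
  assumes closed: "\<lbrakk>a \<in> {0..1}; b \<in> {0..1}\<rbrakk> \<Longrightarrow> S a b \<in> {0..1}"
    and assoc: "\<lbrakk>a \<in> {0..1}; b \<in> {0..1}; c \<in> {0..1}\<rbrakk> \<Longrightarrow> S (S a b) c = S a (S b c)"
    and comm: "\<lbrakk>a \<in> {0..1}; b \<in> {0..1}\<rbrakk> \<Longrightarrow> S a b = S b a"
    and cont: "continuous_on ({0..1} \<times> {0..1}) (\<lambda>(a, b). S a b)"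
    and unit: "a \<in> {0..1} \<Longrightarrow> S a 0 = a"
    and mono: "\<lbrakk>a \<in> {0..1}; b \<in> {0..1}; c \<in> {0..1}; d \<in> {0..1}; a \<le> c; b \<le> d\<rbrakk>
      \<Longrightarrow> S a b \<le> S c d"

locale intuitionistic_fuzzy_metric_space =
  fixes X :: "'a set"
    and M N :: "'a \<Rightarrow> 'a \<Rightarrow> real \<Rightarrow> real"
    and T S :: "real \<Rightarrow> real \<Rightarrow> real"
  assumes nonempty: "X \<noteq> {}"
    and t_norm: "continuous_t_norm T"
    and t_conorm: "continuous_t_conorm S"
    and M_range: "\<lbrakk>x \<in> X; y \<in> X; t > 0\<rbrakk> \<Longrightarrow> M x y t \<in> {0..1}"
    and N_range: "\<lbrakk>x \<in> X; y \<in> X; t > 0\<rbrakk> \<Longrightarrow> N x y t \<in> {0..1}"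
    and M_add_N_le_1: "\<lbrakk>x \<in> X; y \<in> X; t > 0\<rbrakk> \<Longrightarrow> M x y t + N x y t \<le> 1"
    and M_pos: "\<lbrakk>x \<in> X; y \<in> X; t > 0\<rbrakk> \<Longrightarrow> M x y t > 0"
    and M_eq_1_iff: "\<lbrakk>x \<in> X; y \<in> X; t > 0\<rbrakk> \<Longrightarrow> M x y t = 1 \<longleftrightarrow> x = y"
    and M_commute: "\<lbrakk>x \<in> X; y \<in> X; t > 0\<rbrakk> \<Longrightarrow> M x y t = M y x t"
    and M_triangle: "\<lbrakk>x \<in> X; y \<in> X; z \<in> X; t > 0; s > 0\<rbrakk>
      \<Longrightarrow> T (M x y t) (M y z s) \<le> M x z (t + s)"
    and M_cont: "\<lbrakk>x \<in> X; y \<in> X\<rbrakk> \<Longrightarrow> continuous_on {0<..} (M x y)"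
    and N_less_1: "\<lbrakk>x \<in> X; y \<in> X; t > 0\<rbrakk> \<Longrightarrow> N x y t < 1"
    and N_eq_0_iff: "\<lbrakk>x \<in> X; y \<in> X; t > 0\<rbrakk> \<Longrightarrow> N x y t = 0 \<longleftrightarrow> x = y"
    and N_commute: "\<lbrakk>x \<in> X; y \<in> X; t > 0\<rbrakk> \<Longrightarrow> N x y t = N y x t"
    and N_triangle: "\<lbrakk>x \<in> X; y \<in> X; z \<in> X; t > 0; s > 0\<rbrakk>
      \<Longrightarrow> S (N x y t) (N y z s) \<ge> N x z (t + s)"
    and N_cont: "\<lbrakk>x \<in> X; y \<in> X\<rbrakk> \<Longrightarrow> continuous_on {0<..} (N x y)"

definition if_ball ::
    "'a set \<Rightarrow> ('a \<Rightarrow> 'a \<Rightarrow> real \<Rightarrow> real) \<Rightarrow> ('a \<Rightarrow> 'a \<Rightarrow> real \<Rightarrow> real) \<Rightarrow> 'a \<Rightarrow> real \<Rightarrow> real \<Rightarrow> 'a set"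
  where "if_ball X M N x r t = {y \<in> X. M x y t > 1 - r \<and> N x y t < r}"

definition if_open ::
    "'a set \<Rightarrow> ('a \<Rightarrow> 'a \<Rightarrow> real \<Rightarrow> real) \<Rightarrow> ('a \<Rightarrow> 'a \<Rightarrow> real \<Rightarrow> real) \<Rightarrow> 'a set \<Rightarrow> bool"
  where "if_open X M N U \<longleftrightarrow>
    U \<subseteq> X \<and> (\<forall>x\<in>U. \<exists>t r. t > 0 \<and> 0 < r \<and> r < 1 \<and> if_ball X M N x r t \<subseteq> U)"

text \<open>
  The abstraction \<open>topology\<close> is only meaningful for families satisfying \<open>istopology\<close>; in an
  intuitionistic fuzzy metric space this is shown below, so that the open sets are exactly
  those given by \<open>if_open\<close>.
\<close>

definition if_topology ::
    "'a set \<Rightarrow> ('a \<Rightarrow> 'a \<Rightarrow> real \<Rightarrow> real) \<Rightarrow> ('a \<Rightarrow> 'a \<Rightarrow> real \<Rightarrow> real) \<Rightarrow> 'a topology"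
  where "if_topology X M N = topology (if_open X M N)"

definition if_converges ::
    "('a \<Rightarrow> 'a \<Rightarrow> real \<Rightarrow> real) \<Rightarrow> ('a \<Rightarrow> 'a \<Rightarrow> real \<Rightarrow> real) \<Rightarrow> (nat \<Rightarrow> 'a) \<Rightarrow> 'a \<Rightarrow> bool"
  where "if_converges M N \<sigma> x \<longleftrightarrow>
    (\<forall>t>0. (\<lambda>n. M (\<sigma> n) x t) \<longlonglongrightarrow> 1 \<and> (\<lambda>n. N (\<sigma> n) x t) \<longlonglongrightarrow> 0)"

definition if_Cauchy ::
    "('a \<Rightarrow> 'a \<Rightarrow> real \<Rightarrow> real) \<Rightarrow> ('a \<Rightarrow> 'a \<Rightarrow> real \<Rightarrow> real) \<Rightarrow> (nat \<Rightarrow> 'a) \<Rightarrow> bool"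
  where "if_Cauchy M N \<sigma> \<longleftrightarrow>
    (\<forall>\<epsilon> t. 0 < \<epsilon> \<and> \<epsilon> < 1 \<and> t > 0 \<longrightarrow>
      (\<exists>n0. \<forall>n\<ge>n0. \<forall>m\<ge>n0. M (\<sigma> n) (\<sigma> m) t > 1 - \<epsilon> \<and> N (\<sigma> n) (\<sigma> m) t < \<epsilon>))"

definition if_complete ::
    "('a \<Rightarrow> 'a \<Rightarrow> real \<Rightarrow> real) \<Rightarrow> ('a \<Rightarrow> 'a \<Rightarrow> real \<Rightarrow> real) \<Rightarrow> 'a set \<Rightarrow> bool"
  where "if_complete M N A \<longleftrightarrow>
    (\<forall>\<sigma>. range \<sigma> \<subseteq> A \<and> if_Cauchy M N \<sigma> \<longrightarrow> (\<exists>x\<in>A. if_converges M N \<sigma> x))"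

definition if_precompact ::
    "'a set \<Rightarrow> ('a \<Rightarrow> 'a \<Rightarrow> real \<Rightarrow> real) \<Rightarrow> ('a \<Rightarrow> 'a \<Rightarrow> real \<Rightarrow> real) \<Rightarrow> 'a set \<Rightarrow> bool"
  where "if_precompact X M N A \<longleftrightarrow>
    (\<forall>r t. 0 < r \<and> r < 1 \<and> t > 0 \<longrightarrow>
      (\<exists>F. finite F \<and> F \<subseteq> A \<and> A \<subseteq> (\<Union>x\<in>F. if_ball X M N x r t)))"

context intuitionistic_fuzzy_metric_space
begin

lemma M_mono:
  assumes "x \<in> X" "y \<in> X" "0 < s" "s \<le> t"
  shows "M x y s \<le> M x y t"
proof (cases "s = t")
  case False
  then have d: "t - s > 0" using assms by simp
  have "M x y s = T (M x y s) (M y y (t - s))"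
    using continuous_t_norm.unit[OF t_norm M_range] M_eq_1_iff[of y y "t - s"] assms d by simp
  also have "\<dots> \<le> M x y t"
    using M_triangle[of x y y s "t - s"] assms d by simp
  finally show ?thesis .
qed simp

lemma N_antimono:
  assumes "x \<in> X" "y \<in> X" "0 < s" "s \<le> t"
  shows "N x y t \<le> N x y s"
proof (cases "s = t")
  case False
  then have d: "t - s > 0" using assms by simp
  have "N x y t \<le> S (N x y s) (N y y (t - s))"
    using N_triangle[of x y y s "t - s"] assms d by simp
  also have "\<dots> = N x y s"
    using continuous_t_conorm.unit[OF t_conorm N_range] N_eq_0_iff[of y y "t - s"] assms d by simp
  finally show ?thesis .
qed simp

lemma if_ball_mono:
  assumes "x \<in> X" "0 < s" "s \<le> t" "q \<le> r"
  shows "if_ball X M N x q s \<subseteq> if_ball X M N x r t"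
proof
  fix y assume y: "y \<in> if_ball X M N x q s"
  then have "y \<in> X" by (simp add: if_ball_def)
  with y show "y \<in> if_ball X M N x r t"
    using M_mono[of x y s t] N_antimono[of x y s t] assms by (auto simp: if_ball_def)
qed

lemma istopology_if_open: "istopology (if_open X M N)"
  unfolding istopology_def
proof (intro conjI allI impI)
  fix U V assume U: "if_open X M N U" and V: "if_open X M N V"
  show "if_open X M N (U \<inter> V)"
    unfolding if_open_def
  proof (intro conjI ballI)
    show "U \<inter> V \<subseteq> X" using U by (auto simp: if_open_def)
  next
    fix x assume x: "x \<in> U \<inter> V"
    then have "x \<in> X" using U by (auto simp: if_open_def)
    obtain t r where 1: "t > 0" "0 < r" "r < 1" "if_ball X M N x r t \<subseteq> U"
      using U x by (auto simp: if_open_def)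
    obtain s q where 2: "s > 0" "0 < q" "q < 1" "if_ball X M N x q s \<subseteq> V"
      using V x by (auto simp: if_open_def)
    have "if_ball X M N x (min r q) (min t s) \<subseteq> U \<inter> V"
      using if_ball_mono[OF \<open>x \<in> X\<close>, of "min t s" t "min r q" r]
        if_ball_mono[OF \<open>x \<in> X\<close>, of "min t s" s "min r q" q] 1 2 by auto
    moreover have "min t s > 0" "0 < min r q" "min r q < 1" using 1 2 by auto
    ultimately show "\<exists>t r. t > 0 \<and> 0 < r \<and> r < 1 \<and> if_ball X M N x r t \<subseteq> U \<inter> V"
      by blast
  qed
next
  fix K assume "\<forall>U\<in>K. if_open X M N U"
  then show "if_open X M N (\<Union>K)"
    unfolding if_open_def by (meson Sup_least UnionE Union_upper subset_trans)
qed

lemma openin_if_topology: "openin (if_topology X M N) U \<longleftrightarrow> if_open X M N U"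
  by (simp add: if_topology_def istopology_if_open topology_inverse')

lemma topspace_if_topology: "topspace (if_topology X M N) = X"
proof -
  have "if_ball X M N x r t \<subseteq> X" for x r t by (auto simp: if_ball_def)
  then have "if_open X M N X"
    unfolding if_open_def by (auto intro!: exI[of _ "1::real"] exI[of _ "1/2::real"])
  then show ?thesis
    unfolding topspace_def openin_if_topology by (auto simp: if_open_def)
qed

end

end

theory Submission
  imports Defs
begin

text \<open>
  The sets \<open>disc x r = B(x,r,r)\<close> behave like the entourages of a uniformity: they are symmetric,
  decrease with \<open>r\<close>, and continuity of the t-norm at \<open>(1,1)\<close> and of the t-conorm at \<open>(0,0)\<close>
  supplies, for each \<open>r\<close>, a \<open>q\<close> such that two steps of size \<open>q\<close> stay within one step of size \<open>r\<close>.
  The classical argument for metric spaces then applies. Over a compact set a Cauchy sequence has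
  a cluster point, which is its limit. Conversely, if an open cover of a precompact set \<open>A\<close> had no
  finite subcover, then repeatedly intersecting with discs of radius tending to \<open>0\<close> would give
  nested subsets of \<open>A\<close> that are not finitely covered; by completeness they shrink to a point of
  \<open>A\<close>, so eventually they lie in a single member of the cover.
\<close>

section \<open>Continuity of the t-norm and the t-conorm at their units\<close>

lemma (in continuous_t_norm) near_1:
  assumes "0 < r"
  shows "\<exists>d>0. \<forall>a\<in>{0..1}. \<forall>b\<in>{0..1}. a > 1 - d \<longrightarrow> b > 1 - d \<longrightarrow> T a b > 1 - r"
proof -
  obtain d where d: "d > 0"
    "\<And>p. p \<in> {0..1} \<times> {0..1} \<Longrightarrow> dist p (1, 1) < d \<Longrightarrow>
      dist (case p of (a, b) \<Rightarrow> T a b) (case (1, 1) of (a, b) \<Rightarrow> T a b) < r"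
    using cont[unfolded continuous_on_iff, rule_format, of "(1, 1)" r] assms by auto
  \<comment> \<open>The product distance is at most the sum of the coordinate distances, so each
    coordinate gets \<open>d / 2\<close>.\<close>
  have "T a b > 1 - r"
    if "a \<in> {0..1}" "b \<in> {0..1}" "a > 1 - d / 2" "b > 1 - d / 2" for a b
  proof -
    have "dist (a, b) (1, 1) \<le> dist a 1 + dist b 1"
      unfolding dist_prod_def by (auto intro: order.trans[OF sqrt_add_le_add_sqrt])
    also have "\<dots> < d" using that by (auto simp: dist_real_def)
    finally have "dist (T a b) (T 1 1) < r" using d(2)[of "(a, b)"] that by simp
    then show ?thesis using unit[of 1] by (auto simp: dist_real_def)
  qed
  then show ?thesis using d(1) by (intro exI[of _ "d / 2"]) auto
qed

lemma (in continuous_t_conorm) near_0: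
  assumes "0 < r"
  shows "\<exists>d>0. \<forall>a\<in>{0..1}. \<forall>b\<in>{0..1}. a < d \<longrightarrow> b < d \<longrightarrow> S a b < r"
proof -
  obtain d where d: "d > 0"
    "\<And>p. p \<in> {0..1} \<times> {0..1} \<Longrightarrow> dist p (0, 0) < d \<Longrightarrow>
      dist (case p of (a, b) \<Rightarrow> S a b) (case (0, 0) of (a, b) \<Rightarrow> S a b) < r"
    using cont[unfolded continuous_on_iff, rule_format, of "(0, 0)" r] assms by auto
  have "S a b < r"
    if "a \<in> {0..1}" "b \<in> {0..1}" "a < d / 2" "b < d / 2" for a b
  proof -
    have "dist (a, b) (0, 0) \<le> dist a 0 + dist b 0"
      unfolding dist_prod_def by (auto intro: order.trans[OF sqrt_add_le_add_sqrt])
    also have "\<dots> < d" using that by (auto simp: dist_real_def)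
    finally have "dist (S a b) (S 0 0) < r" using d(2)[of "(a, b)"] that by simp
    then show ?thesis using unit[of 0] by (auto simp: dist_real_def)
  qed
  then show ?thesis using d(1) by (intro exI[of _ "d / 2"]) auto
qed

section \<open>Discs as entourages of a uniformity\<close>

context intuitionistic_fuzzy_metric_space
begin

abbreviation disc :: "'a \<Rightarrow> real \<Rightarrow> 'a set"
  where "disc x r \<equiv> if_ball X M N x r r"

lemma disc_subset: "disc x r \<subseteq> X"
  by (auto simp: if_ball_def)

lemma disc_refl: "x \<in> disc x r" if "x \<in> X" "0 < r"
  using that M_eq_1_iff[of x x r] N_eq_0_iff[of x x r] by (simp add: if_ball_def)

lemma disc_sym: "y \<in> disc x r \<Longrightarrow> x \<in> disc y r" if "x \<in> X" "0 < r"
  using that M_commute[of x y r] N_commute[of x y r] by (simp add: if_ball_def)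

lemma disc_mono: "disc x q \<subseteq> disc x r" if "x \<in> X" "0 < q" "q \<le> r"
  using that if_ball_mono by blast

text \<open>Balls grow with both parameters, so \<open>min r t\<close> serves as the single radius.
  This is why discs suffice to describe the topology.\<close>

lemma disc_in_ball:
  assumes "x \<in> X" "0 < r" "r < 1" "0 < t"
  shows "\<exists>q. 0 < q \<and> q < 1 \<and> disc x q \<subseteq> if_ball X M N x r t"
  using if_ball_mono[of x "min r t" t "min r t" r] assms
  by (intro exI[of _ "min r t"]) auto

lemma disc_compose:
  assumes "0 < r" "r < 1"
  shows "\<exists>q. 0 < q \<and> q \<le> r \<and> (\<forall>x\<in>X. \<forall>y z. y \<in> disc x q \<longrightarrow> z \<in> disc y q \<longrightarrow> z \<in> disc x r)"
proof -
  obtain d where d: "d > 0"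
    "\<And>a b. a \<in> {0..1} \<Longrightarrow> b \<in> {0..1} \<Longrightarrow> a > 1 - d \<Longrightarrow> b > 1 - d \<Longrightarrow> T a b > 1 - r"
    using continuous_t_norm.near_1[OF t_norm assms(1)] by blast
  obtain e where e: "e > 0"
    "\<And>a b. a \<in> {0..1} \<Longrightarrow> b \<in> {0..1} \<Longrightarrow> a < e \<Longrightarrow> b < e \<Longrightarrow> S a b < r"
    using continuous_t_conorm.near_0[OF t_conorm assms(1)] by blast
  \<comment> \<open>The triangle inequalities add the parameters, which \<open>r / 2\<close> keeps
    below \<open>r\<close>; \<open>d\<close> and \<open>e\<close> keep the values of
    \<open>M\<close> and \<open>N\<close> where \<open>T\<close> and \<open>S\<close> are
    controlled.\<close>
  define q where "q = min (r / 2) (min d e)"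
  have q: "0 < q" "q + q \<le> r" "q \<le> d" "q \<le> e" using d(1) e(1) assms by (auto simp: q_def)
  have "z \<in> disc x r" if x: "x \<in> X" and "y \<in> disc x q" "z \<in> disc y q" for x y z
  proof -
    have y: "y \<in> X" "M x y q > 1 - q" "N x y q < q"
      and z: "z \<in> X" "M y z q > 1 - q" "N y z q < q"
      using that by (auto simp: if_ball_def)
    have "1 - r < T (M x y q) (M y z q)"
      using d(2) M_range x y z q by simp
    also have "\<dots> \<le> M x z (q + q)" using M_triangle x y z q by blast
    also have "\<dots> \<le> M x z r" using M_mono x z q by simp
    finally have 1: "M x z r > 1 - r" .
    have "N x z r \<le> N x z (q + q)" using N_antimono x z q by simp
    also have "\<dots> \<le> S (N x y q) (N y z q)" using N_triangle x y z q by blast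
    also have "\<dots> < r" using e(2) N_range x y z q by simp
    finally show ?thesis using 1 z by (simp add: if_ball_def)
  qed
  moreover have "q \<le> r" using q by simp
  ultimately show ?thesis using q(1) by blast
qed

section \<open>Open sets and finite covers by discs\<close>

lemma open_contains_disc:
  assumes "if_open X M N U" "x \<in> U"
  shows "\<exists>r. 0 < r \<and> r < 1 \<and> disc x r \<subseteq> U"
proof -
  obtain t r where r: "t > 0" "0 < r" "r < 1" "if_ball X M N x r t \<subseteq> U" and x: "x \<in> X"
    using assms unfolding if_open_def by blast
  show ?thesis using disc_in_ball[OF x r(2,3,1)] r(4) by (meson order.trans)
qed

text \<open>The topological interior of the disc, from which open covers are built.\<close>

definition disc_interior :: "'a \<Rightarrow> real \<Rightarrow> 'a set"
  where "disc_interior x r = {y \<in> X. \<exists>q. 0 < q \<and> q < 1 \<and> disc y q \<subseteq> disc x r}"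

lemma open_disc_interior: "if_open X M N (disc_interior x r)"
  unfolding if_open_def
proof (intro conjI ballI)
  fix y assume "y \<in> disc_interior x r"
  then obtain q where y: "y \<in> X" and q: "0 < q" "q < 1" "disc y q \<subseteq> disc x r"
    by (auto simp: disc_interior_def)
  \<comment> \<open>Every \<open>z\<close> in \<open>disc y p\<close> then has
    \<open>disc z p\<close> inside \<open>disc y q\<close>, hence inside
    \<open>disc x r\<close>.\<close>
  obtain p where p: "0 < p" "p \<le> q"
    "\<And>z w. z \<in> disc y p \<Longrightarrow> w \<in> disc z p \<Longrightarrow> w \<in> disc y q"
    using disc_compose[OF q(1,2)] y by blast
  have "disc y p \<subseteq> disc_interior x r"
    unfolding disc_interior_def using p q disc_subset[of y p]
    by (auto intro!: exI[of _ p])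
  then show "\<exists>t r'. t > 0 \<and> 0 < r' \<and> r' < 1 \<and> if_ball X M N y r' t \<subseteq> disc_interior x r"
    using p q by (intro exI[of _ p]) auto
qed (auto simp: disc_interior_def)

lemma disc_interior_centre: "x \<in> disc_interior x r" if "x \<in> X" "0 < r" "r < 1"
  using that by (auto simp: disc_interior_def)

lemma disc_interior_subset: "disc_interior x r \<subseteq> disc x r"
  using disc_refl by (auto simp: disc_interior_def)

text \<open>The interiors form an open cover indexed by \<open>A\<close>, so a finite subcover keeps
  its centres in \<open>A\<close>. The radius may vary with the centre, as the search for a cluster
  point requires.\<close>

lemma compactin_finite_discs:
  assumes "compactin (if_topology X M N) A" "\<And>x. x \<in> A \<Longrightarrow> 0 < r x \<and> r x < 1"
  shows "\<exists>F. finite F \<and> F \<subseteq> A \<and> A \<subseteq> (\<Union>x\<in>F. disc x (r x))"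
proof -
  have A: "A \<subseteq> X" using compactin_subset_topspace[OF assms(1)] by (simp add: topspace_if_topology)
  let ?\<U> = "(\<lambda>x. disc_interior x (r x)) ` A"
  have "A \<subseteq> \<Union>?\<U>" using disc_interior_centre assms(2) A by blast
  then obtain \<F> where \<F>: "finite \<F>" "\<F> \<subseteq> ?\<U>" "A \<subseteq> \<Union>\<F>"
    using compactinD[OF assms(1), of ?\<U>] open_disc_interior by (auto simp: openin_if_topology)
  obtain F where "F \<subseteq> A" "finite F" "\<F> = (\<lambda>x. disc_interior x (r x)) ` F"
    using finite_subset_image[OF \<F>(1,2)] by blast
  then show ?thesis using \<F>(3) disc_interior_subset by (intro exI[of _ F]) blast
qed

section \<open>Convergence and Cauchy sequences in terms of discs\<close>

lemma if_convergesI: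
  assumes "range \<sigma> \<subseteq> X" "x \<in> X"
    and ev: "\<And>r. 0 < r \<Longrightarrow> r < 1 \<Longrightarrow> \<forall>\<^sub>F n in sequentially. \<sigma> n \<in> disc x r"
  shows "if_converges M N \<sigma> x"
  unfolding if_converges_def
proof (intro allI impI)
  fix t :: real assume t: "t > 0"
  have X: "\<sigma> n \<in> X" for n using assms(1) by auto
  have "\<forall>\<^sub>F n in sequentially. dist (M (\<sigma> n) x t) 1 < e \<and> dist (N (\<sigma> n) x t) 0 < e"
    if "e > 0" for e
  proof -
    \<comment> \<open>The bound \<open>1 / 2\<close> keeps the radius below 1 when \<open>e\<close>
      is large.\<close>
    obtain q where q: "0 < q" "q < 1" "disc x q \<subseteq> if_ball X M N x (min e (1 / 2)) t"
      using disc_in_ball[of x "min e (1 / 2)" t] assms(2) t \<open>e > 0\<close>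
      by (auto simp: min_less_iff_disj)
    show ?thesis
      using ev[OF q(1,2)]
    proof eventually_elim
      case (elim n)
      then have "M x (\<sigma> n) t > 1 - e" "N x (\<sigma> n) t < e"
        using q(3) by (auto simp: if_ball_def)
      then show ?case
        using M_range[OF X \<open>x \<in> X\<close> t, of n] N_range[OF X \<open>x \<in> X\<close> t, of n]
          M_commute[OF X \<open>x \<in> X\<close> t, of n] N_commute[OF X \<open>x \<in> X\<close> t, of n]
        by (auto simp: dist_real_def)
    qed
  qed
  then show "(\<lambda>n. M (\<sigma> n) x t) \<longlonglongrightarrow> 1 \<and> (\<lambda>n. N (\<sigma> n) x t) \<longlonglongrightarrow> 0"
    unfolding tendsto_iff by (auto simp: eventually_conj_iff)
qed

lemma if_converges_disc:
  assumes "range \<sigma> \<subseteq> X" "x \<in> X" "if_converges M N \<sigma> x" "0 < r"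
  shows "\<forall>\<^sub>F n in sequentially. \<sigma> n \<in> disc x r"
proof -
  have X: "\<sigma> n \<in> X" for n using assms(1) by auto
  have "\<forall>\<^sub>F n in sequentially. M (\<sigma> n) x r > 1 - r" "\<forall>\<^sub>F n in sequentially. N (\<sigma> n) x r < r"
    using assms(3,4) by (auto simp: if_converges_def intro: order_tendstoD)
  then show ?thesis
    by eventually_elim
      (use X M_commute[OF X assms(2,4)] N_commute[OF X assms(2,4)] in \<open>simp add: if_ball_def\<close>)
qed

lemma if_CauchyI:
  assumes "range \<sigma> \<subseteq> X"
    and ex: "\<And>r. 0 < r \<Longrightarrow> r < 1 \<Longrightarrow> \<exists>n0. \<forall>n\<ge>n0. \<forall>m\<ge>n0. \<sigma> m \<in> disc (\<sigma> n) r"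
  shows "if_Cauchy M N \<sigma>"
  unfolding if_Cauchy_def
proof (intro allI impI, elim conjE)
  fix \<epsilon> t :: real assume et: "0 < \<epsilon>" "\<epsilon> < 1" "0 < t"
  then obtain n0 where n0: "\<And>n m. n \<ge> n0 \<Longrightarrow> m \<ge> n0 \<Longrightarrow> \<sigma> m \<in> disc (\<sigma> n) (min \<epsilon> t)"
    using ex[of "min \<epsilon> t"] by (auto simp: min_less_iff_disj)
  have "\<sigma> m \<in> if_ball X M N (\<sigma> n) \<epsilon> t" if "n \<ge> n0" "m \<ge> n0" for n m
    using n0[OF that] if_ball_mono[of "\<sigma> n" "min \<epsilon> t" t "min \<epsilon> t" \<epsilon>] et assms(1) by auto
  then show "\<exists>n0. \<forall>n\<ge>n0. \<forall>m\<ge>n0. M (\<sigma> n) (\<sigma> m) t > 1 - \<epsilon> \<and> N (\<sigma> n) (\<sigma> m) t < \<epsilon>"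
    by (auto simp: if_ball_def)
qed

lemma if_Cauchy_disc:
  assumes "range \<sigma> \<subseteq> X" "if_Cauchy M N \<sigma>" "0 < r" "r < 1"
  shows "\<exists>n0. \<forall>n\<ge>n0. \<forall>m\<ge>n0. \<sigma> m \<in> disc (\<sigma> n) r"
  using assms(2)[unfolded if_Cauchy_def, rule_format, of r r] assms(1,3,4)
  by (auto simp: if_ball_def)

section \<open>Compact sets are precompact and complete\<close>

lemma compactin_imp_precompact:
  assumes "compactin (if_topology X M N) A"
  shows "if_precompact X M N A"
  unfolding if_precompact_def
proof (intro allI impI, elim conjE)
  fix r t :: real assume rt: "0 < r" "r < 1" "0 < t"
  have A: "A \<subseteq> X" using compactin_subset_topspace[OF assms] by (simp add: topspace_if_topology)
  obtain F where F: "finite F" "F \<subseteq> A" "A \<subseteq> (\<Union>x\<in>F. disc x (min r t))"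
    using compactin_finite_discs[OF assms, of "\<lambda>_. min r t"] rt by (auto simp: min_less_iff_disj)
  have "disc x (min r t) \<subseteq> if_ball X M N x r t" if "x \<in> F" for x
    using if_ball_mono[of x "min r t" t "min r t" r] rt that F A by auto
  then show "\<exists>F. finite F \<and> F \<subseteq> A \<and> A \<subseteq> (\<Union>x\<in>F. if_ball X M N x r t)"
    using F by (intro exI[of _ F]) blast
qed

lemma compactin_imp_complete:
  assumes "compactin (if_topology X M N) A"
  shows "if_complete M N A"
  unfolding if_complete_def
proof (intro allI impI, elim conjE)
  fix \<sigma> :: "nat \<Rightarrow> 'a" assume \<sigma>: "range \<sigma> \<subseteq> A" and Cauchy: "if_Cauchy M N \<sigma>"
  have A: "A \<subseteq> X" using compactin_subset_topspace[OF assms] by (simp add: topspace_if_topology)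
  \<comment> \<open>A cluster point exists: otherwise finitely many discs, each visited only
    finitely often, would cover \<open>A\<close> and leave only finitely many indices.\<close>
  have "\<exists>x\<in>A. \<forall>r. 0 < r \<and> r < 1 \<longrightarrow> infinite {n. \<sigma> n \<in> disc x r}"
  proof (rule ccontr)
    assume "\<not> ?thesis"
    then obtain r where r: "\<And>x. x \<in> A \<Longrightarrow> 0 < r x \<and> r x < 1 \<and> finite {n. \<sigma> n \<in> disc x (r x)}"
      by metis
    have "0 < r x \<and> r x < 1" if "x \<in> A" for x using r[OF that] by simp
    from compactin_finite_discs[of A r, OF assms this]
    obtain F where F: "finite F" "F \<subseteq> A" "A \<subseteq> (\<Union>x\<in>F. disc x (r x))" by blast
    have "\<exists>x\<in>F. \<sigma> n \<in> disc x (r x)" for n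
      using subsetD[OF F(3), of "\<sigma> n"] \<sigma> by auto
    then have "(\<Union>x\<in>F. {n. \<sigma> n \<in> disc x (r x)}) = UNIV" by auto
    moreover have "finite (\<Union>x\<in>F. {n. \<sigma> n \<in> disc x (r x)})"
      using F(1) r[OF subsetD[OF F(2)]] by (intro finite_UN_I) auto
    ultimately show False by simp
  qed
  then obtain x where x: "x \<in> A" and inf: "\<And>r. 0 < r \<Longrightarrow> r < 1 \<Longrightarrow> infinite {n. \<sigma> n \<in> disc x r}"
    by blast
  \<comment> \<open>The cluster point is the limit: some term beyond \<open>n0\<close> is
    \<open>q\<close>-close to \<open>x\<close>, and all terms from \<open>n0\<close> on are
    \<open>q\<close>-close to that term.\<close>
  have "\<forall>\<^sub>F n in sequentially. \<sigma> n \<in> disc x r" if r: "0 < r" "r < 1" for r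
  proof -
    obtain q where q: "0 < q" "q \<le> r"
      "\<And>y z. y \<in> disc x q \<Longrightarrow> z \<in> disc y q \<Longrightarrow> z \<in> disc x r"
      using disc_compose[OF r] x A by blast
    obtain n0 where n0: "\<And>n m. n \<ge> n0 \<Longrightarrow> m \<ge> n0 \<Longrightarrow> \<sigma> m \<in> disc (\<sigma> n) q"
      using if_Cauchy_disc[OF order.trans[OF \<sigma> A] Cauchy q(1)] q(2) r(2) by auto
    obtain n where "n \<ge> n0" "\<sigma> n \<in> disc x q"
      using inf[OF q(1)] q(2) r(2) unfolding infinite_nat_iff_unbounded_le by force
    then show ?thesis
      using n0 q(3) by (auto simp: eventually_sequentially intro!: exI[of _ n0])
  qed
  then show "\<exists>x\<in>A. if_converges M N \<sigma> x"
    using if_convergesI[of \<sigma> x] \<sigma> A x by blast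
qed

section \<open>Precompact complete sets are compact\<close>

lemma precompact_complete_imp_compactin:
  assumes A: "A \<subseteq> X" and pre: "if_precompact X M N A" and complete: "if_complete M N A"
  shows "compactin (if_topology X M N) A"
  unfolding compactin_def topspace_if_topology openin_if_topology
proof (intro conjI A allI impI, elim conjE, rule ccontr)
  fix \<U> assume open_\<U>: "\<forall>U\<in>\<U>. if_open X M N U" and cover: "A \<subseteq> \<Union>\<U>"
    and none: "\<not> (\<exists>\<F>. finite \<F> \<and> \<F> \<subseteq> \<U> \<and> A \<subseteq> \<Union>\<F>)"
  define covered where "covered C \<longleftrightarrow> (\<exists>\<F>. finite \<F> \<and> \<F> \<subseteq> \<U> \<and> C \<subseteq> \<Union>\<F>)" for C
  define bad where "bad C \<longleftrightarrow> C \<subseteq> A \<and> \<not> covered C" for C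
  \<comment> \<open>The shift by 2 keeps every radius strictly below 1, also at
    \<open>n = 0\<close>.\<close>
  define r where "r n = 1 / (real n + 2)" for n
  have r: "0 < r n" "r n < 1" for n by (auto simp: r_def)
  have r_lim: "r \<longlonglongrightarrow> 0"
    unfolding r_def using LIMSEQ_ignore_initial_segment[OF lim_1_over_n, of 2] by (simp add: add.commute)
  have shrink: "\<exists>C'. bad C' \<and> C' \<subseteq> C \<and> (\<exists>x\<in>A. C' \<subseteq> disc x (r n))" if C: "bad C" for C n
  proof -
    obtain F where F: "finite F" "F \<subseteq> A" "A \<subseteq> (\<Union>x\<in>F. disc x (r n))"
      using pre[unfolded if_precompact_def, rule_format, of "r n" "r n"] r[of n] by blast
    \<comment> \<open>If every piece were finitely covered, the union of these finitely many finite
      families would cover \<open>C\<close>.\<close>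
    have "\<exists>x\<in>F. bad (C \<inter> disc x (r n))"
    proof (rule ccontr)
      assume "\<not> ?thesis"
      then have "\<forall>x\<in>F. covered (C \<inter> disc x (r n))"
        using C unfolding bad_def by blast
      then obtain \<F> where \<F>: "\<forall>x\<in>F. finite (\<F> x) \<and> \<F> x \<subseteq> \<U> \<and> C \<inter> disc x (r n) \<subseteq> \<Union>(\<F> x)"
        unfolding covered_def by metis
      have "finite (\<Union>x\<in>F. \<F> x)" "(\<Union>x\<in>F. \<F> x) \<subseteq> \<U>" using F(1) \<F> by auto
      moreover have "C \<subseteq> \<Union>(\<Union>x\<in>F. \<F> x)"
      proof
        fix c assume c: "c \<in> C"
        then have "c \<in> A" using C unfolding bad_def by blast
        then obtain x where x: "x \<in> F" "c \<in> disc x (r n)" using subsetD[OF F(3)] by blast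
        then have "c \<in> \<Union>(\<F> x)" using \<F> c by blast
        then show "c \<in> \<Union>(\<Union>x\<in>F. \<F> x)" using x(1) by blast
      qed
      ultimately have "covered C" unfolding covered_def by blast
      then show False using C unfolding bad_def by blast
    qed
    then show ?thesis using F(2) by blast
  qed
  have "\<exists>C. \<forall>n. bad (C n) \<and> (C (Suc n) \<subseteq> C n \<and> (\<exists>x\<in>A. C (Suc n) \<subseteq> disc x (r n)))"
  proof (rule dependent_nat_choice)
    show "\<exists>C. bad C" using none unfolding bad_def covered_def by blast
  qed (use shrink in blast)
  then obtain C where bad: "\<And>n. bad (C n)" and dec: "\<And>n. C (Suc n) \<subseteq> C n"
    and "\<And>n. \<exists>x\<in>A. C (Suc n) \<subseteq> disc x (r n)" by blast
  then obtain x where x: "\<And>n. x n \<in> A" "\<And>n. C (Suc n) \<subseteq> disc (x n) (r n)" by metis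
  have C_antimono: "C m \<subseteq> C n" if "n \<le> m" for m n
    using lift_Suc_antimono_le[of C, OF dec that] .
  have C_A: "C n \<subseteq> A" for n using bad unfolding bad_def by blast
  \<comment> \<open>The empty family covers the empty set, so bad sets are nonempty and a point can
    be chosen in each.\<close>
  have "covered {}" unfolding covered_def by blast
  then have "\<forall>n. \<exists>y. y \<in> C n" using bad unfolding bad_def by (metis ex_in_conv)
  then obtain y where y: "\<And>n. y n \<in> C n" by metis
  have y_X: "range y \<subseteq> X" and y_A: "range y \<subseteq> A" using y C_A A by blast+
  \<comment> \<open>This replaces diameters tending to 0: any two points of \<open>C (Suc n)\<close>
    are joined by two \<open>q\<close>-steps through the centre \<open>x n\<close>, the first one by
    symmetry.\<close>
  have small: "\<exists>n. \<forall>u\<in>C n. C n \<subseteq> disc u e" if e: "0 < e" "e < 1" for e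
  proof -
    obtain q where q: "0 < q" "q \<le> e"
      "\<And>u v w. u \<in> X \<Longrightarrow> v \<in> disc u q \<Longrightarrow> w \<in> disc v q \<Longrightarrow> w \<in> disc u e"
      using disc_compose[OF e] by blast
    obtain n where "r n < q"
      using order_tendstoD(2)[OF r_lim q(1)] by (auto simp: eventually_sequentially)
    then have "C (Suc n) \<subseteq> disc (x n) q"
      using x(2)[of n] disc_mono[of "x n" "r n" q] x(1)[of n] A r by force
    moreover have "x n \<in> disc u q" if "u \<in> disc (x n) q" for u
      using disc_sym[OF _ q(1) that] x(1) A by blast
    ultimately have "\<forall>u\<in>C (Suc n). C (Suc n) \<subseteq> disc u e"
      using q(3) C_A A by blast
    then show ?thesis ..
  qed
  have "if_Cauchy M N y"
  proof (rule if_CauchyI[OF y_X])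
    fix e :: real assume "0 < e" "e < 1"
    then obtain n where "\<And>u. u \<in> C n \<Longrightarrow> C n \<subseteq> disc u e" using small by blast
    moreover have "y m \<in> C n" if "m \<ge> n" for m
      using y[of m] C_antimono[OF that] by blast
    ultimately show "\<exists>n0. \<forall>n\<ge>n0. \<forall>m\<ge>n0. y m \<in> disc (y n) e" by blast
  qed
  then obtain z where z: "z \<in> A" "if_converges M N y z"
    using complete y_A unfolding if_complete_def by blast
  obtain U where U: "U \<in> \<U>" "z \<in> U" using cover z by blast
  then obtain e where e: "0 < e" "e < 1" "disc z e \<subseteq> U"
    using open_contains_disc open_\<U> by blast
  \<comment> \<open>One \<open>q\<close>-step will lead from \<open>z\<close> to some
    \<open>y k\<close>, a second from \<open>y k\<close> to any point of a small
    \<open>C n\<close>.\<close>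
  obtain q where q: "0 < q" "q \<le> e"
    "\<And>v w. v \<in> disc z q \<Longrightarrow> w \<in> disc v q \<Longrightarrow> w \<in> disc z e"
    using disc_compose[OF e(1,2)] z A by blast
  obtain n where n: "\<And>u. u \<in> C n \<Longrightarrow> C n \<subseteq> disc u q"
    using small[OF q(1)] q(2) e(2) by force
  have "\<forall>\<^sub>F k in sequentially. y k \<in> disc z q"
    using if_converges_disc[OF y_X _ z(2) q(1)] z(1) A by blast
  then obtain k0 where k0: "\<And>k. k \<ge> k0 \<Longrightarrow> y k \<in> disc z q"
    unfolding eventually_sequentially by blast
  \<comment> \<open>Beyond \<open>k0\<close> the point \<open>y k\<close> is close to
    \<open>z\<close>; beyond \<open>n\<close> it lies in \<open>C n\<close>, as the sets are
    nested.\<close>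
  define k where "k = max k0 n"
  have k: "y k \<in> disc z q" "n \<le> k" by (auto simp: k_def intro: k0)
  have "y k \<in> C n" using subsetD[OF C_antimono[OF k(2)] y] .
  then have "C n \<subseteq> U" using n[of "y k"] q(3)[OF k(1)] e(3) by blast
  then have "covered (C n)" unfolding covered_def using U(1) by (intro exI[of _ "{U}"]) auto
  then show False using bad[of n] unfolding bad_def by blast
qed

end

theorem corollary2p7:
  fixes X A :: "'a set"
    and M N :: "'a \<Rightarrow> 'a \<Rightarrow> real \<Rightarrow> real"
    and T S :: "real \<Rightarrow> real \<Rightarrow> real"
  assumes "intuitionistic_fuzzy_metric_space X M N T S"
    and "A \<subseteq> X"
  shows "compactin (if_topology X M N) A \<longleftrightarrow> if_precompact X M N A \<and> if_complete M N A"
proof -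
  interpret intuitionistic_fuzzy_metric_space X M N T S by fact
  show ?thesis
    using compactin_imp_precompact compactin_imp_complete
      precompact_complete_imp_compactin[OF assms(2)] by blast
qed

end
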